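(* There are absolute constants $K,m>0$ such that the following holds for all positive integers $t,d$ and all integers $r\ge 2$. Let $L=\left(\ln(2+t+d+r)\right)^m$, and let $N$ be an integer with \[ N \ge 1.6\, t + K\left(r\sqrt{td}+r^2 d\right)L \quad\text{if } r\ge 3, \qquad N\ge 2t + K\left(\sqrt{td}+d\right)L \quad \text{if } r=2. \] Suppose we are given $N$ families of $r$ points each in $\mathbb{R}^d$, considered as color classes. Then there is a partition of the union of the families into $r$ sets $A_1,\ldots,A_r$, each containing exactly one point of each color, such that even if any $t$ color classes are removed, the convex hulls of what is left in each $A_i$ intersect, i.e. the $r$ convex hulls have a common point.
   Context: The paper states the number of families as $(1.6)t+\tilde O(r\sqrt{td}+r^2d)$ for $r\ge 3$ and $2t+\tilde O(\sqrt{td}+d)$ for $r=2$, where $\tilde O(\cdot)$ hides an absolute constant and only polylogarithmic factors in $r,t,d$; the claim writes this out explicitly. Points belonging to different color classes are regarded as different (labelled) points. *)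

theory Defs
  imports "HOL-Analysis.Analysis" "HOL-Analysis.Finite_Function_Topology"
begin

(* R^d for a dimension d that may be quantified inside a formula: the coordinate subspace
   spanned by the first d unit vectors in the real vector space of finitely supported
   sequences.  Only the vector space structure (through convex hulls) is used, and the
   convex hull of a subset of this subspace stays in the subspace. *)
definition real_space :: "nat \<Rightarrow> (nat, real) poly_mapping set" where
  "real_space d = {x. Poly_Mapping.keys x \<subseteq> {..<d}}"

(* N color classes of r labelled points each: the pair (c, j) is the j-th point of color c.
   Working with labels keeps points of different colors apart even if their positions
   coincide. *)
definition colored_points :: "nat \<Rightarrow> nat \<Rightarrow> (nat \<times> nat) set" where
  "colored_points N r = {..<N} \<times> {..<r}"

definition colorful_partition :: "nat \<Rightarrow> nat \<Rightarrow> (nat \<Rightarrow> (nat \<times> nat) set) \<Rightarrow> bool" where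
  "colorful_partition N r A \<longleftrightarrow>
     (\<Union>i<r. A i) = colored_points N r \<and> disjoint_family_on A {..<r} \<and>
     (\<forall>i<r. \<forall>c<N. \<exists>!x. x \<in> A i \<and> fst x = c)"

(* P c j is the position of the labelled point (c, j); T is the set of removed colors. *)
definition remaining_positions ::
    "(nat \<Rightarrow> nat \<Rightarrow> 'v) \<Rightarrow> nat set \<Rightarrow> (nat \<times> nat) set \<Rightarrow> 'v set" where
  "remaining_positions P T B = {P c j | c j. (c, j) \<in> B \<and> c \<notin> T}"

end

theory Submission
  imports Defs "HOL-Combinatorics.Permutations"
begin

text \<open>
  The partition is chosen at random: in every color the \<open>r\<close> points are distributed over the
  parts by an independent, uniformly random permutation. With positive probability this
  partition tolerates the removal of any \<open>t\<close> colors.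

  Sarkaria's tensor trick turns the conclusion into a statement about half-spaces. Attach to the
  parts vectors \<open>v\<^sub>0, \<dots>, v\<^sub>r\<^sub>-\<^sub>1\<close> of \<open>\<real>\<^sup>r\<^sup>-\<^sup>1\<close> whose only linear relation, up to scaling, is that they add up to
  zero, and lift a point \<open>p\<close> of part \<open>k\<close> to \<open>(p, 1) \<otimes> v\<^sub>k\<close>. If the convex hulls of
  the parts have no common point, then the origin is outside the convex hull of the lifted points
  and some linear functional is negative on all of them (\<open>sarkaria_separation\<close>, by way of
  Gordan's theorem \<open>gordan_alternative\<close>). Say that a functional \<open>f\<close> is hit by a color if \<open>f\<close> is
  nonnegative on the lift of one of its points. If every \<open>f\<close> is hit by more than \<open>t\<close> colors, then after the
  removal of \<open>t\<close> colors every \<open>f\<close> is still hit, so the hulls intersect.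

  Fix \<open>f\<close> and a color. Since the \<open>r\<close> possible lifts of each point add up to zero, each point has a
  part in which its lift is nonnegative for \<open>f\<close>. Hence a permutation by which the color misses \<open>f\<close> avoids one
  forbidden part for every point. The number of such permutations is largest if the forbidden parts are all
  distinct, when these are the derangements up to relabelling; their proportion is \<open>1/2\<close> for \<open>r = 2\<close> and
  at most \<open>3/8\<close> for \<open>r \<ge> 3\<close>, with equality at \<open>r = 4\<close> (\<open>card_avoiding_perms_le\<close>). So each color hits
  \<open>f\<close> with probability at least \<open>p = 1/2\<close> or \<open>p = 5/8\<close>, which is where \<open>2 t\<close> and \<open>1.6 t\<close> come from.

  By a Chernoff bound (\<open>card_few_hits_le\<close>) a fixed \<open>f\<close> is hit by at most \<open>t\<close> colors with
  probability at most \<open>exp (- (p N - t)\<^sup>2 / (4 p N))\<close>. Only the set of lifts at which \<open>f\<close> is negative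
  matters, and by the Sauer-Shelah lemma (\<open>card_halfspace_traces_le\<close>) there are at most
  \<open>(N r\<^sup>2 + 1) ^ ((r - 1) (d + 1))\<close> such sets. The union bound over them succeeds as soon as
  \<open>N - t / p\<close> exceeds a large multiple of \<open>(r \<surd>(t d) + r\<^sup>2 d) ln (2 + t + d + r)\<close>
  (\<open>patterns_lt_exp\<close>), so a single logarithmic factor is enough.
\<close>

section \<open>Gordan's theorem of the alternative\<close>

text \<open>
  The coordinate functionals of a basis of \<open>span S\<close>. They make the induction on the dimension in
  Gordan's theorem possible without any choice of coordinates in the ambient space.
\<close>
lemma finite_separating_functionals:
  fixes S :: "'v::real_vector set"
  assumes "finite S"
  shows "\<exists>\<Phi> :: ('v \<Rightarrow> real) set. finite \<Phi> \<and> (\<forall>\<phi>\<in>\<Phi>. linear \<phi>) \<and>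
           (\<forall>x\<in>span S. (\<forall>\<phi>\<in>\<Phi>. \<phi> x = 0) \<longrightarrow> x = 0)"
proof -
  obtain B where B: "B \<subseteq> S" "independent B" "S \<subseteq> span B"
    using maximal_independent_subset[of S] by blast
  have finB: "finite B" using B(1) assms by (rule finite_subset)
  have "\<exists>g::'v \<Rightarrow> real. linear g \<and> (\<forall>x\<in>B. g x = (if x = b then 1 else 0))" for b
    using linear_independent_extend[OF B(2), of "\<lambda>x. if x = b then 1 else 0"] by simp
  then obtain g :: "'v \<Rightarrow> 'v \<Rightarrow> real"
    where g: "\<And>b. linear (g b)" "\<And>b x. x \<in> B \<Longrightarrow> g b x = (if x = b then 1 else 0)"
    by metis
  have "x = 0" if x: "x \<in> span S" and z: "\<forall>b\<in>B. g b x = 0" for x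
  proof -
    have "x \<in> span B" using x B(3) by (meson span_minimal span_span subspace_span subset_iff)
    then obtain u where u: "x = (\<Sum>a\<in>B. u a *\<^sub>R a)"
      using finB by (auto simp: span_finite)
    have "u b = 0" if "b \<in> B" for b
    proof -
      have "g b x = (\<Sum>a\<in>B. u a * g b a)"
        unfolding u by (simp add: linear_sum[OF g(1)] linear_scale[OF g(1)])
      also have "\<dots> = (\<Sum>a\<in>B. if a = b then u a else 0)"
        by (rule sum.cong) (auto simp: g(2))
      also have "\<dots> = u b" using finB that by simp
      finally show ?thesis using z that by simp
    qed
    then show "x = 0" unfolding u by simp
  qed
  then show ?thesis
    using finB g(1) by (intro exI[of _ "g ` B"]) auto
qed

text \<open>
  Fourier-Motzkin elimination, one functional \<open>\<phi>\<close> at a time. The hyperplane \<open>\<phi> = 0\<close> is crossed by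
  each segment from a point of \<open>S\<close> where \<open>\<phi>\<close> is positive to one where it is negative. A functional that is
  negative on these crossing points and on the points of \<open>S\<close> in the hyperplane becomes negative on
  \<open>S\<close> after a suitable multiple of \<open>\<phi>\<close> is added: each point off the hyperplane bounds the
  multiplier from one side, and the crossing points make the bounds compatible.
\<close>
lemma gordan_alternative_aux:
  fixes S :: "'v::real_vector set"
  assumes "finite \<Phi>" "finite S" "\<forall>\<phi>\<in>\<Phi>. linear (\<phi> :: 'v \<Rightarrow> real)"
    and "\<forall>x\<in>convex hull S. (\<forall>\<phi>\<in>\<Phi>. \<phi> x = 0) \<longrightarrow> x = 0"
    and "0 \<notin> convex hull S"
  shows "\<exists>f. linear f \<and> (\<forall>x\<in>S. f x < (0::real))"
  using assms
proof (induction \<Phi> arbitrary: S rule: finite_induct)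
  case empty
  then have "S = {}"
    using hull_inc by fastforce
  then show ?case by (intro exI[of _ "\<lambda>_. 0"]) (simp add: linear_zero)
next
  case (insert \<phi> \<Phi>)
  have lin: "linear \<phi>" using insert.prems by auto
  define cross where "cross v w = (\<phi> v / (\<phi> v - \<phi> w)) *\<^sub>R w + (- \<phi> w / (\<phi> v - \<phi> w)) *\<^sub>R v" for v w
  define S' where "S' = {v\<in>S. \<phi> v = 0} \<union>
      (\<lambda>(v, w). cross v w) ` ({v\<in>S. \<phi> v > 0} \<times> {w\<in>S. \<phi> w < 0})"
  have cross_hull: "cross v w \<in> convex hull S" and cross0: "\<phi> (cross v w) = 0"
    if "v \<in> S" "w \<in> S" "\<phi> v > 0" "\<phi> w < 0" for v w
  proof -
    show "cross v w \<in> convex hull S" unfolding cross_def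
      by (rule convexD[OF convex_convex_hull])
         (use that in \<open>auto simp: hull_inc divide_simps\<close>)
    show "\<phi> (cross v w) = 0" unfolding cross_def
      using that by (simp add: linear_add[OF lin] linear_diff[OF lin] linear_scale[OF lin] field_simps)
  qed
  have S'hull: "S' \<subseteq> convex hull S" and S'0: "S' \<subseteq> {x. \<phi> x = 0}"
    unfolding S'_def using cross_hull cross0 by (auto simp: hull_inc)
  have hull': "convex hull S' \<subseteq> convex hull S" using S'hull by (intro hull_minimal convex_convex_hull)
  have "subspace {x. \<phi> x = 0}"
    using lin by (rule linear_subspace_kernel)
  then have hull0: "convex hull S' \<subseteq> {x. \<phi> x = 0}"
    using S'0 by (intro hull_minimal subspace_imp_convex)
  have "finite S'" unfolding S'_def using insert.prems by auto
  moreover have "\<forall>x\<in>convex hull S'. (\<forall>\<phi>\<in>\<Phi>. \<phi> x = 0) \<longrightarrow> x = 0"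
    using insert.prems(3) hull' hull0 by auto
  moreover have "0 \<notin> convex hull S'" using hull' insert.prems by auto
  ultimately have "\<exists>f. linear f \<and> (\<forall>x\<in>S'. f x < (0::real))"
    using insert.prems(2) by (intro insert.IH) simp_all
  then obtain f where f: "linear f" "\<forall>x\<in>S'. f x < (0::real)" by blast
  have comp: "f w / (- \<phi> w) < f v / (- \<phi> v)" 
    if "v \<in> S" "w \<in> S" "\<phi> v > 0" "\<phi> w < 0" for v w
  proof -
    have "f (cross v w) < 0" using f(2) that unfolding S'_def by blast
    then have "(\<phi> v * f w - \<phi> w * f v) / (\<phi> v - \<phi> w) < 0" unfolding cross_def
      by (simp add: linear_add[OF f(1)] linear_diff[OF f(1)] linear_scale[OF f(1)] diff_divide_distrib)
    then have "\<phi> v * f w - \<phi> w * f v < 0" using that by (simp add: divide_less_0_iff)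
    then show ?thesis using that by (simp add: field_simps)
  qed
  \<comment> \<open>Lower and upper bounds for the multiplier \<open>c\<close> for which \<open>f + c \<phi>\<close> is negative off the hyperplane.\<close>
  define lo where "lo = (\<lambda>w. f w / (- \<phi> w)) ` {w\<in>S. \<phi> w < 0}"
  define up where "up = (\<lambda>v. f v / (- \<phi> v)) ` {v\<in>S. \<phi> v > 0}"
  have fin: "finite lo" "finite up" unfolding lo_def up_def using insert.prems by auto
  have lu: "a < b" if "a \<in> lo" "b \<in> up" for a b
    using that comp unfolding lo_def up_def by auto
  have "\<exists>c. (\<forall>a\<in>lo. a < c) \<and> (\<forall>b\<in>up. c < b)"
  proof -
    consider "lo = {}" | "up = {}" | "lo \<noteq> {}" "up \<noteq> {}" by blast
    then show ?thesis
    proof cases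
      case 1
      have "Min (insert 0 up) - 1 < b" if "b \<in> up" for b
      proof -
        have "Min (insert 0 up) \<le> b" using fin that by (intro Min_le) auto
        then show ?thesis by linarith
      qed
      then show ?thesis using 1 by blast
    next
      case 2
      have "a < Max (insert 0 lo) + 1" if "a \<in> lo" for a
      proof -
        have "a \<le> Max (insert 0 lo)" using fin that by (intro Max_ge) auto
        then show ?thesis by linarith
      qed
      then show ?thesis using 2 by blast
    next
      case 3
      then have "Max lo < Min up" using fin lu by simp
      then obtain c where "Max lo < c" "c < Min up" using dense by blast
      then show ?thesis using fin 3 by auto
    qed
  qed
  then obtain c where c: "\<forall>a\<in>lo. a < c" "\<forall>b\<in>up. c < b" by blast
  have "f x + c * \<phi> x < 0" if "x \<in> S" for x
  proof -
    consider "\<phi> x = 0" | "\<phi> x > 0" | "\<phi> x < 0" by linarith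
    then show ?thesis
    proof cases
      case 1
      then show ?thesis using f(2) that unfolding S'_def by auto
    next
      case 2
      then have "c < f x / (- \<phi> x)" using c(2) that unfolding up_def by blast
      then show ?thesis using 2 by (simp add: field_simps)
    next
      case 3
      then have "f x / (- \<phi> x) < c" using c(1) that unfolding lo_def by blast
      then show ?thesis using 3 by (simp add: field_simps)
    qed
  qed
  moreover have "linear (\<lambda>x. f x + c * \<phi> x)"
    using linear_compose_add[OF f(1) linear_compose_scale_right[OF lin, of c]] by simp
  ultimately show ?case by blast
qed

theorem gordan_alternative:
  fixes S :: "'v::real_vector set"
  assumes "finite S" "0 \<notin> convex hull S"
  obtains f where "linear f" "\<forall>x\<in>S. f x < (0::real)"
proof -
  obtain \<Phi> :: "('v \<Rightarrow> real) set"
    where \<Phi>: "finite \<Phi> \<and> (\<forall>\<phi>\<in>\<Phi>. linear \<phi>) \<and>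
      (\<forall>x\<in>span S. (\<forall>\<phi>\<in>\<Phi>. \<phi> x = 0) \<longrightarrow> x = 0)"
    using finite_separating_functionals[OF assms(1)] by (rule exE)
  have "convex hull S \<subseteq> span S" by (rule convex_hull_subset_span)
  then have "\<exists>f. linear f \<and> (\<forall>x\<in>S. f x < (0::real))"
    using \<Phi> assms by (intro gordan_alternative_aux[of \<Phi>]) auto
  then show ?thesis using that by blast
qed

section \<open>Sign patterns of linear functionals\<close>

definition shatters :: "'a set set \<Rightarrow> 'a set \<Rightarrow> bool" where
  "shatters F S \<longleftrightarrow> (\<forall>U\<subseteq>S. \<exists>A\<in>F. A \<inter> S = U)"

text \<open>
  Pajor's strengthening of the Sauer-Shelah lemma. For the induction, split \<open>F\<close> with respect to
  a point \<open>x\<close> into the traces \<open>F1\<close> off \<open>x\<close> and the sets \<open>F2\<close> that occur both with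
  and without \<open>x\<close>. A set shattered by \<open>F2\<close> is still shattered by \<open>F\<close> after \<open>x\<close> is added to it.
\<close>
lemma card_le_card_shattered:
  assumes "finite V" "F \<subseteq> Pow V"
  shows "card F \<le> card {S. S \<subseteq> V \<and> shatters F S}"
  using assms
proof (induction V arbitrary: F rule: finite_induct)
  case empty
  then consider "F = {}" | "F = {{}}" by auto
  then show ?case
  proof cases
    case 2
    then have "{S. S \<subseteq> {} \<and> shatters F S} = {{}}" unfolding shatters_def by auto
    then show ?thesis using 2 by simp
  qed simp
next
  case (insert x V)
  define F1 where "F1 = (\<lambda>A. A - {x}) ` F"
  define F2 where "F2 = {A. A \<subseteq> V \<and> A \<in> F \<and> insert x A \<in> F}"
  let ?Sh = "\<lambda>F. {S. S \<subseteq> V \<and> shatters F S}"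
  have finF: "finite F" using insert finite_subset by fastforce
  have F1V: "F1 \<subseteq> Pow V" and F2V: "F2 \<subseteq> Pow V"
    using insert.prems unfolding F1_def F2_def by auto
  have finF2: "finite F2" using F2V insert.hyps finite_subset by fastforce
  have "card F = card F1 + card F2"
  proof -
    have split: "F = (F - insert x ` F2) \<union> insert x ` F2" unfolding F2_def by auto
    have "inj_on (insert x) F2" using insert.hyps unfolding F2_def inj_on_def
      by (metis (no_types, lifting) insert_ident mem_Collect_eq subsetD)
    then have c2: "card (insert x ` F2) = card F2" by (rule card_image)
    have inj: "inj_on (\<lambda>A. A - {x}) (F - insert x ` F2)"
    proof (rule inj_onI)
      fix A B assume A: "A \<in> F - insert x ` F2" and B: "B \<in> F - insert x ` F2"
        and eq: "A - {x} = B - {x}"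
      have key: False if "A' \<in> F - insert x ` F2" "x \<in> A'" "x \<notin> B'" "B' \<in> F" "A' - {x} = B' - {x}" for A' B'
      proof -
        have "B' \<subseteq> V" using that(3,4) insert.prems by auto
        moreover have "insert x B' = A'" using that by auto
        ultimately have "A' \<in> insert x ` F2" unfolding F2_def using that by blast
        then show False using that by auto
      qed
      show "A = B" using key[of A B] key[of B A] A B eq by blast
    qed
    have img: "(\<lambda>A. A - {x}) ` (F - insert x ` F2) = F1"
    proof
      show "(\<lambda>A. A - {x}) ` (F - insert x ` F2) \<subseteq> F1" unfolding F1_def by auto
      show "F1 \<subseteq> (\<lambda>A. A - {x}) ` (F - insert x ` F2)"
      proof
        fix C assume "C \<in> F1"
        then obtain A where A: "A \<in> F" "C = A - {x}" unfolding F1_def by auto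
        show "C \<in> (\<lambda>A. A - {x}) ` (F - insert x ` F2)"
        proof (cases "A \<in> insert x ` F2")
          case True
          then obtain D where D: "A = insert x D" "D \<subseteq> V" "D \<in> F" unfolding F2_def by auto
          have "x \<notin> D" using D insert.hyps by auto
          then have "C = D - {x}" "D \<in> F - insert x ` F2" using A D by auto
          then show ?thesis by blast
        qed (use A in auto)
      qed
    qed
    have "card (F - insert x ` F2) = card F1" using card_image[OF inj] img by simp
    moreover have "card F = card (F - insert x ` F2) + card (insert x ` F2)"
      by (subst split, rule card_Un_disjoint) (use finF finF2 in auto)
    ultimately show ?thesis using c2 by simp
  qed
  also have "\<dots> \<le> card (?Sh F1) + card (?Sh F2)"
    using insert.IH[OF F1V] insert.IH[OF F2V] by simp
  also have "\<dots> = card (?Sh F1) + card (insert x ` ?Sh F2)"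
  proof -
    have "inj_on (insert x) (?Sh F2)" using insert.hyps unfolding inj_on_def
      by (metis (no_types, lifting) insert_ident mem_Collect_eq subsetD)
    then show ?thesis by (simp add: card_image)
  qed
  also have "\<dots> = card (?Sh F1 \<union> insert x ` ?Sh F2)"
    by (rule card_Un_disjoint[symmetric]) (use insert.hyps in auto)
  also have "\<dots> \<le> card {S. S \<subseteq> insert x V \<and> shatters F S}"
  proof (rule card_mono)
    show "finite {S. S \<subseteq> insert x V \<and> shatters F S}" using insert.hyps by auto
    have a: "shatters F S" if "S \<subseteq> V" "shatters F1 S" for S
      unfolding shatters_def
    proof (intro allI impI)
      note S = that
      fix U assume "U \<subseteq> S"
      then obtain A where "A \<in> F" "(A - {x}) \<inter> S = U"
        using S(2) unfolding shatters_def F1_def by auto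
      moreover have "x \<notin> S" using S insert.hyps by auto
      ultimately show "\<exists>A\<in>F. A \<inter> S = U" by auto
    qed
    have b: "shatters F (insert x S)" if "S \<subseteq> V" "shatters F2 S" for S
      unfolding shatters_def
    proof (intro allI impI)
      note S = that
      fix U assume U: "U \<subseteq> insert x S"
      then have "U - {x} \<subseteq> S" by auto
      then obtain A where A: "A \<in> F2" "A \<inter> S = U - {x}"
        using S(2) unfolding shatters_def by blast
      have "x \<notin> A" using A(1) insert.hyps unfolding F2_def by auto
      show "\<exists>A\<in>F. A \<inter> insert x S = U"
      proof (cases "x \<in> U")
        case True
        then have "insert x A \<inter> insert x S = U" using A(2) by auto
        then show ?thesis using A(1) unfolding F2_def by blast
      next
        case False
        then have "A \<inter> insert x S = U" using A(2) \<open>x \<notin> A\<close> by auto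
        then show ?thesis using A(1) unfolding F2_def by blast
      qed
    qed
    show "?Sh F1 \<union> insert x ` ?Sh F2 \<subseteq> {S. S \<subseteq> insert x V \<and> shatters F S}"
      using a b by auto
  qed
  finally show ?case .
qed

text \<open>
  Compare \<open>\<Sum>i\<le>D. n choose i\<close> with the binomial expansion of \<open>(n + 1) ^ D\<close> term by term.
\<close>
lemma card_subsets_card_le:
  assumes "finite V"
  shows "card {S. S \<subseteq> V \<and> card S \<le> D} \<le> (card V + 1) ^ D"
proof -
  have "{S. S \<subseteq> V \<and> card S \<le> D} = (\<Union>i\<le>D. {S. S \<subseteq> V \<and> card S = i})" by auto
  then have "card {S. S \<subseteq> V \<and> card S \<le> D} \<le> (\<Sum>i\<le>D. card {S. S \<subseteq> V \<and> card S = i})"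
    by (simp add: card_UN_le)
  also have "\<dots> = (\<Sum>i\<le>D. card V choose i)" using n_subsets[OF assms] by simp
  also have "\<dots> \<le> (\<Sum>i\<le>D. (D choose i) * card V ^ i)"
  proof (rule sum_mono)
    fix i assume "i \<in> {..D}"
    then have "1 \<le> D choose i" by (simp add: Suc_leI)
    moreover have "card V choose i \<le> card V ^ i"
      by (cases "i \<le> card V") (auto simp: binomial_le_pow binomial_eq_0)
    ultimately show "card V choose i \<le> (D choose i) * card V ^ i"
      using mult_le_mono by fastforce
  qed
  also have "\<dots> = (card V + 1) ^ D" using binomial[of "card V" 1 D] by simp
  finally show ?thesis .
qed

text \<open>
  A shattered set is linearly independent: for a nontrivial relation \<open>\<Sum>v\<in>S. u v *\<^sub>R v = 0\<close>, normalized so that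
  some coefficient is positive, no linear functional can be negative exactly at the \<open>v\<close> with
  \<open>u v > 0\<close>, because the sum of its values weighted by \<open>u\<close> would then be negative.
\<close>
lemma card_le_of_shattered_by_halfspaces:
  fixes S :: "'v::real_vector set"
  assumes "finite B" "V \<subseteq> span B" "S \<subseteq> V" "finite V"
    and sh: "shatters {{v\<in>V. f v < (0::real)} | f. linear f} S"
  shows "card S \<le> card B"
proof (rule ccontr)
  assume "\<not> card S \<le> card B"
  then have dep: "dependent S" using independent_span_bound[OF assms(1)] assms(2,3) by blast
  have finS: "finite S" using assms finite_subset by blast
  obtain u where u: "\<exists>v\<in>S. u v \<noteq> 0" "(\<Sum>v\<in>S. u v *\<^sub>R v) = 0"
    using dep unfolding dependent_finite[OF finS] by blast
  have "\<exists>u. (\<exists>v\<in>S. u v > 0) \<and> (\<Sum>v\<in>S. u v *\<^sub>R v) = 0"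
  proof (cases "\<exists>v\<in>S. u v > 0")
    case False
    then have "\<exists>v\<in>S. - u v > 0" using u(1) by force
    moreover have "(\<Sum>v\<in>S. (- u v) *\<^sub>R v) = 0" using u(2) by (simp add: sum_negf)
    ultimately show ?thesis by (intro exI[of _ "\<lambda>v. - u v"]) simp
  qed (use u in blast)
  then obtain u where u: "\<exists>v\<in>S. u v > 0" "(\<Sum>v\<in>S. u v *\<^sub>R v) = 0" by blast
  have "{v\<in>S. u v > 0} \<subseteq> S" by auto
  then have "\<exists>A\<in>{{v\<in>V. f v < (0::real)} | f. linear f}. A \<inter> S = {v\<in>S. u v > 0}"
    by (rule sh[unfolded shatters_def, rule_format])
  then obtain f :: "'v \<Rightarrow> real"
    where f: "linear f" "{v\<in>V. f v < 0} \<inter> S = {v\<in>S. u v > 0}" by blast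
  have neg: "f v < 0 \<longleftrightarrow> u v > 0" if "v \<in> S" for v using f(2) that assms(3) by blast
  have "0 = f (\<Sum>v\<in>S. u v *\<^sub>R v)" by (simp add: u(2) linear_0[OF f(1)])
  also have "\<dots> = (\<Sum>v\<in>S. u v * f v)"
    by (simp add: linear_sum[OF f(1)] linear_scale[OF f(1)])
  also have "\<dots> < (\<Sum>v\<in>S. 0)"
  proof (rule sum_strict_mono_ex1[OF finS])
    show "\<forall>v\<in>S. u v * f v \<le> 0"
      using neg by (metis linorder_not_less mult_le_0_iff order.order_iff_strict)
    obtain v where "v \<in> S" "u v > 0" using u(1) by blast
    then show "\<exists>v\<in>S. u v * f v < 0" using neg by (intro bexI[of _ v]) (auto simp: mult_less_0_iff)
  qed
  finally show False by simp
qed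

theorem card_halfspace_traces_le:
  fixes V :: "'v::real_vector set"
  assumes "finite V" "finite B" "V \<subseteq> span B"
  shows "card {{v\<in>V. f v < (0::real)} | f. linear f} \<le> (card V + 1) ^ card B"
proof -
  let ?F = "{{v\<in>V. f v < (0::real)} | f. linear f}"
  have "card ?F \<le> card {S. S \<subseteq> V \<and> shatters ?F S}"
    by (rule card_le_card_shattered[OF assms(1)]) auto
  also have "\<dots> \<le> card {S. S \<subseteq> V \<and> card S \<le> card B}"
    using card_le_of_shattered_by_halfspaces[OF assms(2,3) _ assms(1)] assms(1)
    by (intro card_mono) auto
  also have "\<dots> \<le> (card V + 1) ^ card B" by (rule card_subsets_card_le[OF assms(1)])
  finally show ?thesis .
qed

section \<open>Sarkaria's tensor trick\<close>

text \<open>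
  The tensor \<open>(p, 1) \<otimes> v\<^sub>k\<close> as a sequence of \<open>r - 1\<close> blocks, where \<open>v\<^sub>k\<close> is the unit vector \<open>e\<^sub>k\<close> for
  \<open>k < r - 1\<close> and the last \<open>v\<^sub>k\<close> is \<open>- (e\<^sub>0 + \<dots> + e\<^sub>r\<^sub>-\<^sub>2)\<close>.
\<close>
definition sarkaria_vector :: "nat \<Rightarrow> nat \<Rightarrow> 'v::real_vector \<Rightarrow> (nat, 'v \<times> real) poly_mapping" where
  "sarkaria_vector r k p =
     (if k < r - 1 then Poly_Mapping.single k (p, 1)
      else - (\<Sum>i<r - 1. Poly_Mapping.single i (p, 1)))"

lemma lookup_scaleR: "Poly_Mapping.lookup (c *\<^sub>R x) i = c *\<^sub>R Poly_Mapping.lookup x i"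
  for x :: "('i, 'v::real_vector) poly_mapping"
proof -
  have "finite {i. c *\<^sub>R Poly_Mapping.lookup x i \<noteq> 0}"
    by (rule finite_subset[OF _ finite_lookup[of x]]) auto
  then show ?thesis by (simp add: scaleR_poly_mapping_def)
qed

lemma linear_single: "linear (\<lambda>v::'v::real_vector. Poly_Mapping.single i v)"
  by (rule linearI) (auto intro!: poly_mapping_eqI simp: single_add lookup_scaleR lookup_single when_def)

lemma lookup_sarkaria_vector:
  assumes "i < r - 1"
  shows "Poly_Mapping.lookup (sarkaria_vector r k p) i =
    (if k < r - 1 then (if k = i then (p, 1) else 0) else - (p, 1))"
proof -
  have "(\<Sum>j<r - 1. Poly_Mapping.lookup (Poly_Mapping.single j (p, 1::real)) i) =
        (\<Sum>j<r - 1. if j = i then (p, 1) else 0)"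
    by (rule sum.cong) (auto simp: lookup_single when_def)
  also have "\<dots> = (p, 1)" using assms by simp
  finally show ?thesis
    by (auto simp: sarkaria_vector_def lookup_single when_def lookup_sum)
qed

lemma sum_sarkaria_vector:
  assumes "r \<ge> 1"
  shows "(\<Sum>k<r. sarkaria_vector r k p) = 0"
proof -
  obtain n where "r = Suc n" using assms by (cases r) auto
  then show ?thesis by (simp add: sarkaria_vector_def)
qed

text \<open>
  For fixed \<open>k\<close> the lift is an affine map.
\<close>
lemma convex_image_sarkaria_vector:
  assumes "convex S"
  shows "convex (sarkaria_vector r k ` S)"
proof -
  have aff: "sarkaria_vector r k (u *\<^sub>R x + v *\<^sub>R y) =
      u *\<^sub>R sarkaria_vector r k x + v *\<^sub>R sarkaria_vector r k y"
    if "u + v = 1" for u v and x y :: 'a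
  proof -
    have "(u *\<^sub>R x + v *\<^sub>R y, 1::real) = u *\<^sub>R (x, 1) + v *\<^sub>R (y, 1)"
      using that by simp
    then show ?thesis
      unfolding sarkaria_vector_def
      by (simp only: linear_add[OF linear_single] linear_scale[OF linear_single])
         (simp add: sum.distrib scaleR_sum_right)
  qed
  show ?thesis
  proof (rule convexI)
    fix a b :: "(nat, 'a \<times> real) poly_mapping" and u v :: real
    assume "a \<in> sarkaria_vector r k ` S" "b \<in> sarkaria_vector r k ` S" 
      and uv: "0 \<le> u" "0 \<le> v" "u + v = 1"
    then obtain x y where xy: "x \<in> S" "y \<in> S" "a = sarkaria_vector r k x" "b = sarkaria_vector r k y"
      by auto
    have "u *\<^sub>R x + v *\<^sub>R y \<in> S" using assms xy uv by (simp add: convexD)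
    then show "u *\<^sub>R a + v *\<^sub>R b \<in> sarkaria_vector r k ` S"
      unfolding xy(3,4) aff[OF uv(3), of x y, symmetric] by (rule imageI)
  qed
qed

text \<open>
  If the origin were a convex combination \<open>\<Sum>k<r. c k *\<^sub>R (q k, 1) \<otimes> v\<^sub>k\<close> with \<open>q k\<close> in the hull of \<open>R k\<close>, then each
  block would say that \<open>c i *\<^sub>R (q i, 1)\<close> equals \<open>c (r - 1) *\<^sub>R (q (r - 1), 1)\<close>. The last coordinate makes
  the weights equal, hence all the points \<open>q k\<close> coincide and lie in every hull.
\<close>
theorem sarkaria_separation:
  fixes R :: "nat \<Rightarrow> 'v::real_vector set"
  assumes "r \<ge> 1" and ne: "\<forall>k<r. R k \<noteq> {}" and fin: "\<forall>k<r. finite (R k)"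
    and disj: "(\<Inter>k<r. convex hull (R k)) = {}"
  obtains f where "linear f" "\<forall>k<r. \<forall>p\<in>R k. f (sarkaria_vector r k p) < (0::real)"
proof -
  let ?s = "sarkaria_vector r"
  define S where "S = (\<Union>k<r. ?s k ` R k)"
  have "0 \<notin> convex hull S"
  proof
    assume z: "0 \<in> convex hull S"
    have "convex hull S \<subseteq> convex hull (\<Union>k<r. ?s k ` (convex hull (R k)))"
      unfolding S_def by (intro hull_mono UN_mono image_mono hull_subset) auto
    also have "\<dots> = {sum (\<lambda>k. c k *\<^sub>R s k) {..<r} | c s. (\<forall>k\<in>{..<r}. c k \<ge> 0) \<and>
        sum c {..<r} = 1 \<and> (\<forall>k\<in>{..<r}. s k \<in> ?s k ` (convex hull (R k)))}"
      by (rule convex_hull_finite_union)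
         (use ne in \<open>auto simp: convex_image_sarkaria_vector\<close>)
    finally obtain c s where cs: "0 = (\<Sum>k<r. c k *\<^sub>R s k)" "\<forall>k\<in>{..<r}. c k \<ge> (0::real)"
      "sum c {..<r} = 1" "\<forall>k\<in>{..<r}. s k \<in> ?s k ` (convex hull (R k))"
      using z by blast
    have "\<forall>k\<in>{..<r}. \<exists>q. q \<in> convex hull (R k) \<and> s k = ?s k q" using cs(4) by auto
    then obtain q where q: "\<forall>k\<in>{..<r}. q k \<in> convex hull (R k) \<and> s k = ?s k (q k)"
      by (rule bchoice[THEN exE])
    obtain n where n: "r = Suc n" using assms(1) by (cases r) auto
    have eq: "c i *\<^sub>R (q i, 1::real) = c n *\<^sub>R (q n, 1)" if i: "i < n" for i
    proof -
      have "0 = Poly_Mapping.lookup (\<Sum>k<r. c k *\<^sub>R s k) i" unfolding cs(1)[symmetric] by simp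
      also have "\<dots> = (\<Sum>k<r. c k *\<^sub>R Poly_Mapping.lookup (?s k (q k)) i)"
        using q by (simp add: lookup_sum lookup_scaleR)
      also have "\<dots> = (\<Sum>k<n. if k = i then c i *\<^sub>R (q i, 1) else 0) - c n *\<^sub>R (q n, 1)"
      proof -
        have "(\<Sum>k<n. c k *\<^sub>R Poly_Mapping.lookup (?s k (q k)) i) =
              (\<Sum>k<n. if k = i then c i *\<^sub>R (q i, 1) else 0)"
          by (rule sum.cong) (use i n in \<open>auto simp: lookup_sarkaria_vector\<close>)
        moreover have "Poly_Mapping.lookup (?s n (q n)) i = - (q n, 1)"
          using i n by (simp add: lookup_sarkaria_vector)
        ultimately show ?thesis unfolding n sum.lessThan_Suc by simp
      qed
      also have "\<dots> = c i *\<^sub>R (q i, 1) - c n *\<^sub>R (q n, 1)" using i by simp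
      finally have "0 = c i *\<^sub>R (q i, 1::real) - c n *\<^sub>R (q n, 1)" .
      then show ?thesis unfolding eq_commute[of 0] right_minus_eq .
    qed
    have ceq: "c i = c n" if "i < r" for i
      using eq[of i] that n by (cases "i = n") auto
    then have "real r * c n = 1" using cs(3) by simp
    then have "c n \<noteq> 0" by auto
    then have "q i = q n" if "i < r" for i
      using eq[of i] ceq[of i] that n by (cases "i = n") auto
    then have "q n \<in> (\<Inter>k<r. convex hull (R k))" using q by (metis INT_I lessThan_iff)
    then show False using disj by simp
  qed
  moreover have "finite S" unfolding S_def using fin by auto
  ultimately obtain f where "linear f" "\<forall>x\<in>S. f x < (0::real)"
    using gordan_alternative by blast
  then show ?thesis using that[of f] unfolding S_def by auto
qed

text \<open>
  The lifts of a \<open>d\<close>-dimensional space span at most \<open>(r - 1) (d + 1)\<close> dimensions, which is the exponent in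
  the number of sign patterns.
\<close>
lemma exists_spanning_sarkaria_vectors:
  fixes B :: "'v::real_vector set"
  assumes "finite B"
  obtains C :: "(nat, 'v \<times> real) poly_mapping set"
    where "finite C" "card C \<le> (r - 1) * (card B + 1)"
      "\<And>p k. p \<in> span B \<Longrightarrow> sarkaria_vector r k p \<in> span C"
proof -
  define E where "E = insert (0, 1::real) ((\<lambda>b. (b, 0)) ` B)"
  define C where "C = (\<lambda>(i, e). Poly_Mapping.single i e) ` ({..<r - 1} \<times> E)"
  have E: "finite E" "card E \<le> card B + 1"
    unfolding E_def using assms by (auto simp: card_insert_if card_image_le le_SucI)
  have lin: "linear (\<lambda>b::'v. (b, 0::real))" by (rule linearI) auto
  have pE: "(p, 1) \<in> span E" if "p \<in> span B" for p
  proof -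
    have "(p, 0) \<in> span ((\<lambda>b. (b, 0::real)) ` B)"
      using that linear_span_image[OF lin, of B] by auto
    then have "(p, 0) \<in> span E" unfolding E_def using span_mono by (metis insertCI subsetI subsetD)
    moreover have "(0, 1) \<in> span E" unfolding E_def by (simp add: span_base)
    ultimately have "(p, 0) + (0, 1) \<in> span E" by (rule span_add)
    then show ?thesis by simp
  qed
  have single: "Poly_Mapping.single i (p, 1) \<in> span C" if "i < r - 1" "p \<in> span B" for i p
  proof -
    have "Poly_Mapping.single i (p, 1) \<in> Poly_Mapping.single i ` span E" using pE[OF that(2)] by auto
    also have "\<dots> = span (Poly_Mapping.single i ` E)" by (rule linear_span_image[OF linear_single, symmetric])
    also have "\<dots> \<subseteq> span C" unfolding C_def using that(1) by (intro span_mono) auto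
    finally show ?thesis .
  qed
  show ?thesis
  proof
    show "finite C" unfolding C_def using E by auto
    have "card C \<le> (r - 1) * card E"
      unfolding C_def using card_image_le[of "{..<r - 1} \<times> E"] E by (simp add: card_cartesian_product)
    also have "\<dots> \<le> (r - 1) * (card B + 1)" using E(2) by (rule mult_le_mono2)
    finally show "card C \<le> (r - 1) * (card B + 1)" .
    show "sarkaria_vector r k p \<in> span C" if "p \<in> span B" for p k
      using single that unfolding sarkaria_vector_def by (auto intro!: span_neg span_sum)
  qed
qed

section \<open>Permutations that avoid one value at every position\<close>

definition avoiding_perms :: "'a set \<Rightarrow> ('a \<Rightarrow> 'a) \<Rightarrow> ('a \<Rightarrow> 'a) set" where
  "avoiding_perms U c = {\<sigma>. \<sigma> permutes U \<and> (\<forall>j\<in>U. \<sigma> j \<noteq> c j)}"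

text \<open>
  For \<open>n > 0\<close> the alternating sum is \<open>(n - 1) choose 4\<close>. Stopping at \<open>k = 4\<close> is what gives the constant
  \<open>3/8 = 1 - 1 + 1/2 - 1/6 + 1/24\<close>.
\<close>
lemma bonferroni_pointwise:
  "(if n = 0 then 1 else 0) \<le> (\<Sum>k\<le>4. (-1) ^ k * int (n choose k))"
proof (cases n)
  case 0
  then show ?thesis by (simp add: numeral_eq_Suc)
next
  case (Suc m)
  have "(\<Sum>k\<le>4. (-1) ^ k * int (n choose k)) = int (m choose 4)"
    unfolding Suc by (simp add: numeral_eq_Suc)
  then show ?thesis using Suc by simp
qed

text \<open>
  Composition with the inverse of \<open>c\<close> turns agreement with \<open>c\<close> on \<open>S\<close> into fixing \<open>S\<close> pointwise.
\<close>
lemma card_perms_agreeing_on: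
  assumes "finite U" "c permutes U" "S \<subseteq> U"
  shows "card {\<sigma>. \<sigma> permutes U \<and> (\<forall>j\<in>S. \<sigma> j = c j)} = fact (card U - card S)"
proof -
  have "bij_betw (\<lambda>p. c \<circ> p) {p. p permutes U - S} {\<sigma>. \<sigma> permutes U \<and> (\<forall>j\<in>S. \<sigma> j = c j)}"
  proof (rule bij_betwI[where g = "\<lambda>p. inv c \<circ> p"])
    show "(\<lambda>p. c \<circ> p) \<in> {p. p permutes U - S} \<rightarrow> {\<sigma>. \<sigma> permutes U \<and> (\<forall>j\<in>S. \<sigma> j = c j)}"
    proof
      fix p assume "p \<in> {p. p permutes U - S}"
      then have p: "p permutes U - S" by simp
      then have "p permutes U" by (rule permutes_subset) auto
      moreover have "p j = j" if "j \<in> S" for j using p that by (simp add: permutes_not_in)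
      ultimately show "c \<circ> p \<in> {\<sigma>. \<sigma> permutes U \<and> (\<forall>j\<in>S. \<sigma> j = c j)}"
        using assms(2) by (auto intro: permutes_compose)
    qed
    show "(\<lambda>p. inv c \<circ> p) \<in> {\<sigma>. \<sigma> permutes U \<and> (\<forall>j\<in>S. \<sigma> j = c j)} \<rightarrow> {p. p permutes U - S}"
    proof
      fix \<sigma> assume "\<sigma> \<in> {\<sigma>. \<sigma> permutes U \<and> (\<forall>j\<in>S. \<sigma> j = c j)}"
      then have s: "\<sigma> permutes U" "\<And>j. j \<in> S \<Longrightarrow> \<sigma> j = c j" by auto
      have "inv c \<circ> \<sigma> permutes U"
        using permutes_compose[OF s(1) permutes_inv[OF assms(2)]] .
      then have "inv c \<circ> \<sigma> permutes U - S"
        by (rule permutes_superset) (auto simp: s(2) permutes_inverses[OF assms(2)])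
      then show "inv c \<circ> \<sigma> \<in> {p. p permutes U - S}" by simp
    qed
    show "inv c \<circ> (c \<circ> p) = p" for p
      using permutes_inv_o[OF assms(2)] by (simp add: o_assoc)
    show "c \<circ> (inv c \<circ> p) = p" for p
      using permutes_inv_o[OF assms(2)] by (simp add: o_assoc)
  qed
  then have "card {\<sigma>. \<sigma> permutes U \<and> (\<forall>j\<in>S. \<sigma> j = c j)} = card {p. p permutes U - S}"
    by (rule bij_betw_same_card[symmetric])
  also have "\<dots> = fact (card (U - S))" using assms by (intro card_permutations) auto
  also have "card (U - S) = card U - card S"
    using assms by (meson card_Diff_subset finite_subset)
  finally show ?thesis .
qed

text \<open>
  Sum the pointwise inequality over all permutations \<open>\<sigma>\<close>, taking for \<open>n\<close> the number of positions at which \<open>\<sigma>\<close> and \<open>c\<close>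
  agree, and count the pairs of a permutation and a \<open>k\<close>-set of positions of agreement.
\<close>
lemma card_avoiding_perms_permutation:
  assumes fin: "finite U" and c: "c permutes U"
  shows "int (card (avoiding_perms U c)) \<le>
    (\<Sum>k\<le>4. (-1) ^ k * int ((card U choose k) * fact (card U - k)))"
proof -
  let ?P = "{\<sigma>. \<sigma> permutes U}"
  define X where "X \<sigma> = {j\<in>U. \<sigma> j = c j}" for \<sigma>
  have finP: "finite ?P" using fin by (rule finite_permutations)
  have finX: "finite (X \<sigma>)" for \<sigma> unfolding X_def using fin by simp
  have count: "(\<Sum>\<sigma>\<in>?P. card (X \<sigma>) choose k) = (card U choose k) * fact (card U - k)" for k
  proof -
    let ?K = "{S. S \<subseteq> U \<and> card S = k}"
    have finK: "finite ?K" using fin by simp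
    have "(\<Sum>\<sigma>\<in>?P. card (X \<sigma>) choose k) = (\<Sum>\<sigma>\<in>?P. card {S \<in> ?K. S \<subseteq> X \<sigma>})"
    proof (rule sum.cong[OF refl])
      fix \<sigma>
      have "{S \<in> ?K. S \<subseteq> X \<sigma>} = {S. S \<subseteq> X \<sigma> \<and> card S = k}" unfolding X_def by auto
      then show "card (X \<sigma>) choose k = card {S \<in> ?K. S \<subseteq> X \<sigma>}"
        using n_subsets[OF finX] by simp
    qed
    also have "\<dots> = (\<Sum>S\<in>?K. card {\<sigma>\<in>?P. S \<subseteq> X \<sigma>})"
      using sum_multicount_gen[OF finP finK, of "\<lambda>\<sigma> S. S \<subseteq> X \<sigma>" "\<lambda>S. card {\<sigma>\<in>?P. S \<subseteq> X \<sigma>}"]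
      by simp
    also have "\<dots> = (\<Sum>S\<in>?K. fact (card U - k))"
    proof (rule sum.cong[OF refl])
      fix S assume S: "S \<in> ?K"
      then have "{\<sigma>\<in>?P. S \<subseteq> X \<sigma>} = {\<sigma>. \<sigma> permutes U \<and> (\<forall>j\<in>S. \<sigma> j = c j)}"
        unfolding X_def by auto
      then show "card {\<sigma>\<in>?P. S \<subseteq> X \<sigma>} = fact (card U - k)"
        using card_perms_agreeing_on[OF fin c, of S] S by simp
    qed
    also have "\<dots> = (card U choose k) * fact (card U - k)"
      using n_subsets[OF fin] by simp
    finally show ?thesis .
  qed
  have "avoiding_perms U c = {\<sigma>\<in>?P. card (X \<sigma>) = 0}"
    using finX unfolding avoiding_perms_def X_def by auto
  then have "int (card (avoiding_perms U c)) = (\<Sum>\<sigma>\<in>?P. if card (X \<sigma>) = 0 then 1 else 0)"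
    using finP by (simp add: sum.If_cases Int_def)
  also have "\<dots> \<le> (\<Sum>\<sigma>\<in>?P. \<Sum>k\<le>4. (-1) ^ k * int (card (X \<sigma>) choose k))"
    by (intro sum_mono bonferroni_pointwise)
  also have "\<dots> = (\<Sum>k\<le>4. \<Sum>\<sigma>\<in>?P. (-1) ^ k * int (card (X \<sigma>) choose k))"
    by (rule sum.swap)
  also have "\<dots> = (\<Sum>k\<le>4. (-1) ^ k * int (\<Sum>\<sigma>\<in>?P. card (X \<sigma>) choose k))"
    by (simp add: sum_distrib_left)
  finally show ?thesis unfolding count .
qed

text \<open>
  Forbidding at \<open>j\<close> a value \<open>b\<close> that is forbidden nowhere else, instead of \<open>a = c j\<close>, cannot decrease the number of
  avoiding permutations. Among the permutations that satisfy the constraints at the other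
  positions, swapping the values \<open>a\<close> and \<open>b\<close> injects those with \<open>\<sigma> j = b\<close> into those with \<open>\<sigma> j = a\<close>:
  the position that receives \<open>b\<close> in exchange may take it.
\<close>
lemma card_avoiding_perms_redirect:
  assumes fin: "finite U" and c: "c ` U \<subseteq> U" and j: "j \<in> U" and b: "b \<in> U" "b \<notin> c ` U"
  shows "card (avoiding_perms U c) \<le> card (avoiding_perms U (c(j := b)))"
proof -
  define G where "G = {\<sigma>. \<sigma> permutes U \<and> (\<forall>i\<in>U. i \<noteq> j \<longrightarrow> \<sigma> i \<noteq> c i)}"
  define a where "a = c j"
  have aU: "a \<in> U" using c j unfolding a_def by auto
  have finG: "finite G" unfolding G_def using finite_permutations[OF fin] by simp
  have 1: "avoiding_perms U c = G - {\<sigma>\<in>G. \<sigma> j = a}"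
    unfolding avoiding_perms_def G_def a_def using j by auto
  have 2: "avoiding_perms U (c(j := b)) = G - {\<sigma>\<in>G. \<sigma> j = b}"
    unfolding avoiding_perms_def G_def using j by auto
  have "card {\<sigma>\<in>G. \<sigma> j = b} \<le> card {\<sigma>\<in>G. \<sigma> j = a}"
  proof (rule card_inj_on_le[where f = "\<lambda>\<sigma>. Transposition.transpose a b \<circ> \<sigma>"])
    show "inj_on (\<lambda>\<sigma>. Transposition.transpose a b \<circ> \<sigma>) {\<sigma>\<in>G. \<sigma> j = b}"
      by (auto simp: inj_on_def fun_eq_iff dest: transpose_eq_imp_eq)
    show "(\<lambda>\<sigma>. Transposition.transpose a b \<circ> \<sigma>) ` {\<sigma>\<in>G. \<sigma> j = b} \<subseteq> {\<sigma>\<in>G. \<sigma> j = a}"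
    proof (rule image_subsetI)
      fix \<sigma> assume s: "\<sigma> \<in> {\<sigma>\<in>G. \<sigma> j = b}"
      then have p: "\<sigma> permutes U" and av: "\<And>i. i \<in> U \<Longrightarrow> i \<noteq> j \<Longrightarrow> \<sigma> i \<noteq> c i" and sj: "\<sigma> j = b"
        unfolding G_def by auto
      have "Transposition.transpose a b (\<sigma> i) \<noteq> c i" if "i \<in> U" "i \<noteq> j" for i
      proof -
        have "\<sigma> i \<noteq> b" using permutes_inj[OF p] that(2) sj by (metis injD)
        then show ?thesis using av[OF that] b(2) that(1)
          by (cases "\<sigma> i = a") (auto simp: Transposition.transpose_def)
      qed
      moreover have "Transposition.transpose a b \<circ> \<sigma> permutes U"
        using permutes_compose[OF p permutes_swap_id[OF aU b(1)]] .
      ultimately show "Transposition.transpose a b \<circ> \<sigma> \<in> {\<sigma>\<in>G. \<sigma> j = a}"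
        unfolding G_def using sj by simp
    qed
    show "finite {\<sigma>\<in>G. \<sigma> j = a}" using finG by simp
  qed
  moreover have "card (avoiding_perms U c) = card G - card {\<sigma>\<in>G. \<sigma> j = a}"
    unfolding 1 using finG by (intro card_Diff_subset) auto
  moreover have "card (avoiding_perms U (c(j := b))) = card G - card {\<sigma>\<in>G. \<sigma> j = b}"
    unfolding 2 using finG by (intro card_Diff_subset) auto
  ultimately show ?thesis by simp
qed

text \<open>
  While some value is forbidden at two positions, some other value is forbidden nowhere, and redirecting one of
  the two positions to it enlarges the set of forbidden values. The process ends with a bijection.
\<close>
lemma exists_permutation_avoided_more:
  assumes fin: "finite U" and c: "c ` U \<subseteq> U"
  shows "\<exists>d. d permutes U \<and> card (avoiding_perms U c) \<le> card (avoiding_perms U d)"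
  using c
proof (induction "card U - card (c ` U)" arbitrary: c rule: less_induct)
  case less
  show ?case
  proof (cases "c ` U = U")
    case True
    define d where "d = (\<lambda>x. if x \<in> U then c x else x)"
    have "bij_betw c U U" using True fin by (simp add: bij_betw_def eq_card_imp_inj_on)
    then have "bij_betw d U U" unfolding d_def by (simp cong: bij_betw_cong)
    then have "d permutes U" by (rule bij_imp_permutes) (simp add: d_def)
    moreover have "avoiding_perms U d = avoiding_perms U c"
      unfolding avoiding_perms_def d_def by auto
    ultimately show ?thesis by auto
  next
    case False
    then obtain b where b: "b \<in> U" "b \<notin> c ` U" using less.prems by auto
    have "card (c ` U) < card U" using False less.prems fin by (simp add: psubset_card_mono psubset_eq)
    then have "\<not> inj_on c U" using card_image by fastforce
    then obtain i j where ij: "i \<in> U" "j \<in> U" "i \<noteq> j" "c i = c j" unfolding inj_on_def by blast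
    have img: "c(j := b) ` U = insert b (c ` U)"
    proof
      show "insert b (c ` U) \<subseteq> c(j := b) ` U"
      proof
        fix y assume "y \<in> insert b (c ` U)"
        then consider "y = b" | x where "x \<in> U" "y = c x" by auto
        then show "y \<in> c(j := b) ` U"
        proof cases
          case 2
          show ?thesis
          proof (cases "x = j")
            case True
            then have "y = (c(j := b)) i" using 2 ij by simp
            then show ?thesis using ij by blast
          next
            case False
            then have "y = (c(j := b)) x" using 2 by simp
            then show ?thesis using 2 by blast
          qed
        qed (use ij in auto)
      qed
    qed auto
    have "card (c(j := b) ` U) = Suc (card (c ` U))" unfolding img using b fin by simp
    then have "card U - card (c(j := b) ` U) < card U - card (c ` U)"
      using \<open>card (c ` U) < card U\<close> by simp
    moreover have "c(j := b) ` U \<subseteq> U" unfolding img using b less.prems by auto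
    ultimately obtain d where "d permutes U"
      "card (avoiding_perms U (c(j := b))) \<le> card (avoiding_perms U d)"
      using less.hyps[of "c(j := b)"] by blast
    then show ?thesis
      using card_avoiding_perms_redirect[OF fin less.prems ij(2) b] by fastforce
  qed
qed

lemma choose_mult_fact_diff:
  assumes "k \<le> n"
  shows "real ((n choose k) * fact (n - k)) = fact n / fact k"
  using binomial_fact[OF assms, where 'a = real] by (simp add: field_simps)

text \<open>
  The worst case is a permutation \<open>c\<close>, where the truncated inclusion-exclusion sum equals \<open>3/8 r!\<close> for
  \<open>r \<ge> 4\<close>, and \<open>1/3 r!\<close> and \<open>1/2 r!\<close> for \<open>r = 3\<close> and \<open>r = 2\<close>, since the terms with \<open>k > r\<close> vanish.
\<close>
theorem card_avoiding_perms_le: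
  assumes fin: "finite U" and c: "c ` U \<subseteq> U" and r: "card U = r" "r \<ge> 2"
  shows "real (card (avoiding_perms U c)) \<le> (if r = 2 then 1/2 else 3/8) * fact r"
proof -
  obtain d where d: "d permutes U" "card (avoiding_perms U c) \<le> card (avoiding_perms U d)"
    using exists_permutation_avoided_more[OF fin c] by blast
  let ?s = "\<Sum>k\<le>4. (-1) ^ k * real ((r choose k) * fact (r - k))"
  have "int (card (avoiding_perms U d)) \<le>
      (\<Sum>k\<le>4. (-1) ^ k * int ((r choose k) * fact (r - k)))"
    using card_avoiding_perms_permutation[OF fin d(1)] r by simp
  then have "real_of_int (int (card (avoiding_perms U d))) \<le>
      real_of_int (\<Sum>k\<le>4. (-1) ^ k * int ((r choose k) * fact (r - k)))"
    by (simp only: of_int_le_iff)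
  then have le: "real (card (avoiding_perms U c)) \<le> ?s" using d(2) by simp
  consider "r = 2" | "r = 3" | "r \<ge> 4" using r(2) by linarith
  then have "?s \<le> (if r = 2 then 1/2 else 3/8) * fact r"
  proof cases
    case 3
    have "?s = (\<Sum>k\<le>4. (-1) ^ k * (fact r / fact k))"
      using 3 by (intro sum.cong) (simp_all only: choose_mult_fact_diff atMost_iff)
    also have "\<dots> = (3/8) * fact r"
      by (simp add: numeral_eq_Suc field_simps)
    finally show ?thesis using 3 by simp
  qed (simp_all add: numeral_eq_Suc)
  with le show ?thesis by linarith
qed

section \<open>A Chernoff bound for independent choices\<close>

text \<open>
  The exponential moment argument, written as a count of functions: each choice with at most \<open>t\<close> hits has
  weight \<open>exp (l (t - #hits)) \<ge> 1\<close>, and the total weight of all choices is a product over the coordinates.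
\<close>
theorem card_few_hits_le:
  fixes h :: "nat \<Rightarrow> 'b \<Rightarrow> bool" and p :: real
  assumes fin: "finite Q" and p: "0 < p" and N: "N \<ge> 1" and t: "real t \<le> p * N"
    and hit: "\<And>c. c < N \<Longrightarrow> p * card Q \<le> card {\<sigma>\<in>Q. h c \<sigma>}"
  shows "real (card {g \<in> PiE {..<N} (\<lambda>_. Q). card {c. c < N \<and> h c (g c)} \<le> t})
          \<le> real (card Q) ^ N * exp (- ((p * N - t)\<^sup>2 / (4 * (p * N))))"
proof -
  \<comment> \<open>With the bound \<open>exp (- l) \<le> 1 - l + l\<^sup>2\<close> the exponent becomes \<open>- l (p N - t) + l\<^sup>2 p N\<close>,
    which is smallest for this \<open>l\<close>.\<close>
  define l where "l = (p * N - t) / (2 * (p * N))"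
  let ?\<Omega> = "PiE {..<N} (\<lambda>_. Q)"
  let ?H = "\<lambda>g. card {c. c < N \<and> h c (g c)}"
  let ?w = "\<lambda>c \<sigma>. if h c \<sigma> then exp (- l) else 1"
  have pN: "p * N > 0" using p N by simp
  then have l: "l \<ge> 0" unfolding l_def using t by simp
  have finO: "finite ?\<Omega>" using fin by (intro finite_PiE) auto
  have prod: "(\<Prod>c<N. ?w c (g c)) = exp (- l * ?H g)" for g
  proof -
    have "(\<Prod>c<N. ?w c (g c)) = (\<Prod>c\<in>{c\<in>{..<N}. h c (g c)}. exp (- l))"
      by (rule prod.inter_filter[symmetric]) simp
    also have "\<dots> = exp (- l) ^ ?H g" by simp
    finally show ?thesis by (simp add: exp_of_nat_mult[symmetric] mult.commute)
  qed
  have exp_le: "exp (- l) \<le> 1 - (l - l\<^sup>2)"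
  proof -
    have "exp (- l) * (1 + l) \<le> exp (- l) * exp l" by (intro mult_left_mono exp_ge_add_one_self) auto
    also have "\<dots> = 1" by (simp add: exp_minus)
    also have "\<dots> \<le> (1 - (l - l\<^sup>2)) * (1 + l)"
      using l by (simp add: algebra_simps power2_eq_square)
    finally show ?thesis using l by (simp add: mult_le_cancel_right)
  qed
  have factor: "(\<Sum>\<sigma>\<in>Q. ?w c \<sigma>) \<le> card Q * exp (- (p * (l - l\<^sup>2)))" if "c < N" for c
  proof -
    let ?A = "{\<sigma>\<in>Q. h c \<sigma>}"
    have "(\<Sum>\<sigma>\<in>Q. ?w c \<sigma>) = (\<Sum>\<sigma>\<in>Q. 1 - (if h c \<sigma> then 1 - exp (- l) else 0))"
      by (rule sum.cong) auto
    also have "\<dots> = card Q - card ?A * (1 - exp (- l))"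
      using fin by (simp add: sum_subtractf sum.inter_filter[symmetric])
    also have "\<dots> \<le> card Q - p * card Q * (1 - exp (- l))"
      using hit[OF that] l by (intro diff_left_mono mult_right_mono) auto
    also have "\<dots> \<le> card Q * (1 - p * (l - l\<^sup>2))"
    proof -
      have "p * card Q * (l - l\<^sup>2) \<le> p * card Q * (1 - exp (- l))"
        using exp_le p by (intro mult_left_mono) auto
      then show ?thesis by (simp add: algebra_simps)
    qed
    also have "\<dots> \<le> card Q * exp (- (p * (l - l\<^sup>2)))"
      using exp_ge_add_one_self[of "- (p * (l - l\<^sup>2))"] by (intro mult_left_mono) auto
    finally show ?thesis .
  qed
  have "real (card {g\<in>?\<Omega>. ?H g \<le> t}) = (\<Sum>g\<in>{g\<in>?\<Omega>. ?H g \<le> t}. 1)" by simp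
  also have "\<dots> \<le> (\<Sum>g\<in>{g\<in>?\<Omega>. ?H g \<le> t}. exp (l * t) * exp (- l * ?H g))"
  proof (rule sum_mono)
    fix g assume "g \<in> {g\<in>?\<Omega>. ?H g \<le> t}"
    then have "l * ?H g \<le> l * t" using l by (intro mult_left_mono) auto
    then show "1 \<le> exp (l * t) * exp (- l * ?H g)" by (simp add: exp_add[symmetric])
  qed
  also have "\<dots> \<le> (\<Sum>g\<in>?\<Omega>. exp (l * t) * exp (- l * ?H g))"
    using finO by (intro sum_mono2) auto
  also have "\<dots> = exp (l * t) * (\<Sum>g\<in>?\<Omega>. \<Prod>c<N. ?w c (g c))"
    unfolding prod by (simp add: sum_distrib_left)
  also have "\<dots> = exp (l * t) * (\<Prod>c<N. \<Sum>\<sigma>\<in>Q. ?w c \<sigma>)"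
    using fin by (subst prod_sum_PiE) auto
  also have "\<dots> \<le> exp (l * t) * (\<Prod>c<N. card Q * exp (- (p * (l - l\<^sup>2))))"
    using factor by (intro mult_left_mono prod_mono conjI sum_nonneg) auto
  also have "\<dots> = real (card Q) ^ N * exp (l * t - N * (p * (l - l\<^sup>2)))"
    by (simp add: power_mult_distrib exp_of_nat_mult[symmetric] exp_add[symmetric] algebra_simps)
  also have "l * t - N * (p * (l - l\<^sup>2)) = - ((p * N - t)\<^sup>2 / (4 * (p * N)))"
  proof -
    have e: "l * (2 * (p * N)) = p * N - t"
      unfolding l_def using pN by (intro nonzero_divide_eq_eq[THEN iffD1, symmetric, OF _ refl]) linarith
    have "(p * N - t)\<^sup>2 / (4 * (p * N)) = l\<^sup>2 * (p * N)"
      unfolding e[symmetric] using pN by (simp add: power2_eq_square field_simps)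
    moreover have "l * t - N * (p * (l - l\<^sup>2)) = - l * (p * N - t) + l\<^sup>2 * (p * N)"
      by (simp add: algebra_simps)
    moreover have "\<dots> = - (l\<^sup>2 * (p * N))"
      unfolding e[symmetric] by (simp add: power2_eq_square)
    ultimately show ?thesis by simp
  qed
  finally show ?thesis .
qed

section \<open>Colorful Tverberg partitions with tolerance\<close>

definition color_part :: "nat \<Rightarrow> nat \<Rightarrow> (nat \<Rightarrow> nat \<Rightarrow> nat) \<Rightarrow> nat \<Rightarrow> (nat \<times> nat) set" where
  "color_part N r g k = {(c, j). c < N \<and> j < r \<and> g c j = k}"

text \<open>
  The unique point of color \<open>c\<close> in part \<open>i\<close> is the one that the permutation \<open>g c\<close> sends to \<open>i\<close>.
\<close>
lemma colorful_partition_color_part: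
  assumes "\<And>c. c < N \<Longrightarrow> g c permutes {..<r}"
  shows "colorful_partition N r (color_part N r g)"
  unfolding colorful_partition_def
proof (intro conjI allI impI)
  have "g c j < r" if "c < N" "j < r" for c j
    using permutes_in_image[OF assms[OF that(1)], of j] that(2) by simp
  then show "(\<Union>i<r. color_part N r g i) = colored_points N r"
    unfolding color_part_def colored_points_def by auto
  show "disjoint_family_on (color_part N r g) {..<r}"
    unfolding disjoint_family_on_def color_part_def by auto
  fix i c assume ic: "i < r" "c < N"
  note perm = assms[OF ic(2)]
  show "\<exists>!x. x \<in> color_part N r g i \<and> fst x = c"
  proof (rule ex1I[of _ "(c, inv (g c) i)"])
    have "inv (g c) i < r" using permutes_in_image[OF permutes_inv[OF perm], of i] ic by simp
    then show "(c, inv (g c) i) \<in> color_part N r g i \<and> fst (c, inv (g c) i) = c"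
      using ic permutes_inverses(1)[OF perm] by (simp add: color_part_def)
    fix x assume "x \<in> color_part N r g i \<and> fst x = c"
    then show "x = (c, inv (g c) i)"
      using permutes_inverses(2)[OF perm] by (auto simp: color_part_def)
  qed
qed

text \<open>
  The set \<open>W\<close> stands for the lifts at which some linear functional is negative. Stating a hit through \<open>W\<close> instead
  of the functional leaves only finitely many conditions for the union bound.
\<close>
definition hits :: "nat \<Rightarrow> (nat \<Rightarrow> 'v::real_vector) \<Rightarrow> (nat, 'v \<times> real) poly_mapping set
    \<Rightarrow> (nat \<Rightarrow> nat) \<Rightarrow> bool" where
  "hits r p W \<sigma> \<longleftrightarrow> (\<exists>j<r. sarkaria_vector r (\<sigma> j) (p j) \<notin> W)"

text \<open>
  The lifts of \<open>p j\<close> to the \<open>r\<close> parts add up to zero, so \<open>f\<close> is nonnegative at one of them, say for the part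
  \<open>k j\<close>. A permutation without a hit avoids the value \<open>k j\<close> at every \<open>j\<close>.
\<close>
lemma card_hitting_perms_ge:
  fixes p :: "nat \<Rightarrow> 'v::real_vector"
  assumes r: "r \<ge> 2" and f: "linear f" and W: "\<And>v. v \<in> W \<Longrightarrow> f v < (0::real)"
  shows "(if r = 2 then 1/2 else 5/8) * real (card {\<sigma>. \<sigma> permutes {..<r}})
    \<le> real (card {\<sigma>\<in>{\<sigma>. \<sigma> permutes {..<r}}. hits r p W \<sigma>})"
proof -
  let ?s = "sarkaria_vector r"
  let ?Q = "{\<sigma>. \<sigma> permutes {..<r}}"
  have "\<exists>k<r. f (?s k (p j)) \<ge> 0" for j
  proof (rule ccontr)
    assume "\<not> ?thesis"
    then have neg: "f (?s k (p j)) < 0" if "k < r" for k using that by (meson not_le)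
    have "(\<Sum>k<r. f (?s k (p j))) = f (\<Sum>k<r. ?s k (p j))" by (rule linear_sum[OF f, symmetric])
    also have "\<dots> = 0" using r by (simp add: sum_sarkaria_vector linear_0[OF f])
    finally show False using sum_strict_mono[of "{..<r}" "\<lambda>k. f (?s k (p j))" "\<lambda>_. 0"] neg r
      by (simp add: lessThan_empty_iff)
  qed
  then obtain k where k: "\<And>j. k j < r" "\<And>j. f (?s (k j) (p j)) \<ge> 0" by metis
  have finQ: "finite ?Q" by (simp add: finite_permutations)
  have "?Q - {\<sigma>\<in>?Q. hits r p W \<sigma>} \<subseteq> avoiding_perms {..<r} k"
  proof
    fix \<sigma> assume "\<sigma> \<in> ?Q - {\<sigma>\<in>?Q. hits r p W \<sigma>}"
    then have "\<sigma> permutes {..<r}" "\<And>j. j < r \<Longrightarrow> ?s (\<sigma> j) (p j) \<in> W" by (auto simp: hits_def)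
    then show "\<sigma> \<in> avoiding_perms {..<r} k"
      unfolding avoiding_perms_def using W k(2) by (fastforce simp: not_le[symmetric])
  qed
  moreover have "finite (avoiding_perms {..<r} k)"
    by (rule finite_subset[OF _ finQ]) (auto simp: avoiding_perms_def)
  ultimately have miss: "card (?Q - {\<sigma>\<in>?Q. hits r p W \<sigma>}) \<le> card (avoiding_perms {..<r} k)"
    by (intro card_mono)
  have avoid: "real (card (avoiding_perms {..<r} k)) \<le> (if r = 2 then 1/2 else 3/8) * fact r"
    using k(1) r by (intro card_avoiding_perms_le) auto
  have total: "card ?Q = fact r" by (intro card_permutations) auto
  have "card (?Q - {\<sigma>\<in>?Q. hits r p W \<sigma>}) = card ?Q - card {\<sigma>\<in>?Q. hits r p W \<sigma>}"
    using finQ by (intro card_Diff_subset) auto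
  then have "real (card ?Q) \<le> card (?Q - {\<sigma>\<in>?Q. hits r p W \<sigma>}) + card {\<sigma>\<in>?Q. hits r p W \<sigma>}"
    by linarith
  also have "\<dots> \<le> (if r = 2 then 1/2 else 3/8) * fact r + real (card {\<sigma>\<in>?Q. hits r p W \<sigma>})"
    using miss avoid by linarith
  finally show ?thesis unfolding total by (cases "r = 2") simp_all
qed

text \<open>
  The union bound over the sign patterns, for points that span at most \<open>card B\<close> dimensions of an arbitrary real
  vector space. The last assumption says that the number of patterns times the Chernoff bound
  is less than one.
\<close>
theorem tolerant_colorful_tverberg:
  fixes P :: "nat \<Rightarrow> nat \<Rightarrow> 'v::real_vector" and p :: real
  assumes r: "r \<ge> 2" and B: "finite B" and P: "\<And>c j. c < N \<Longrightarrow> j < r \<Longrightarrow> P c j \<in> span B"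
    and p_def: "p = (if r = 2 then 1/2 else 5/8)" and t: "real t < p * N"
    and few: "real (N * r * r + 1) ^ ((r - 1) * (card B + 1))
                < exp ((p * N - t)\<^sup>2 / (4 * (p * N)))"
  obtains A where "colorful_partition N r A"
    "\<And>T. T \<subseteq> {..<N} \<Longrightarrow> card T = t \<Longrightarrow> (\<Inter>i<r. convex hull (remaining_positions P T (A i))) \<noteq> {}"
proof -
  let ?s = "sarkaria_vector r"
  let ?Q = "{\<sigma>. \<sigma> permutes {..<r}}"
  let ?\<Omega> = "PiE {..<N} (\<lambda>_. ?Q)"
  define V where "V = (\<lambda>(c, j, k). ?s k (P c j)) ` ({..<N} \<times> {..<r} \<times> {..<r})"
  define F where "F = {{v\<in>V. f v < (0::real)} | f. linear f}"
  define Bad where "Bad W = {g\<in>?\<Omega>. card {c. c < N \<and> hits r (P c) W (g c)} \<le> t}" for W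
  let ?\<epsilon> = "exp (- ((p * N - t)\<^sup>2 / (4 * (p * N))))"
  have p: "p > 0" "p \<le> 1" unfolding p_def by auto
  then have N: "N \<ge> 1" using t by (cases N) auto
  have finQ: "finite ?Q" by (simp add: finite_permutations)
  have finO: "finite ?\<Omega>" by (intro finite_PiE) (auto simp: finite_permutations)
  have finV: "finite V" unfolding V_def by auto
  have cardV: "card V \<le> N * r * r"
    unfolding V_def using card_image_le[of "{..<N} \<times> {..<r} \<times> {..<r}"]
    by (simp add: card_cartesian_product mult.assoc)
  obtain C :: "(nat, 'v \<times> real) poly_mapping set" where C: "finite C" "card C \<le> (r - 1) * (card B + 1)"
    "\<And>p k. p \<in> span B \<Longrightarrow> ?s k p \<in> span C"
    using exists_spanning_sarkaria_vectors[OF B, of r] by blast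
  have "V \<subseteq> span C" unfolding V_def using C(3) P by auto
  then have "card F \<le> (card V + 1) ^ card C"
    unfolding F_def by (rule card_halfspace_traces_le[OF finV C(1)])
  also have "\<dots> \<le> (N * r * r + 1) ^ card C" using cardV by (intro power_mono) auto
  also have "\<dots> \<le> (N * r * r + 1) ^ ((r - 1) * (card B + 1))"
    using C(2) by (intro power_increasing) auto
  finally have cardF: "real (card F) \<le> real (N * r * r + 1) ^ ((r - 1) * (card B + 1))"
    by (metis of_nat_le_iff of_nat_power)
  have finF: "finite F" by (rule finite_subset[of _ "Pow V"]) (auto simp: F_def finV)
  have card_bad: "real (card (Bad W)) \<le> real (card ?Q) ^ N * ?\<epsilon>" if W: "W \<in> F" for W
    unfolding Bad_def
  proof (rule card_few_hits_le[OF finQ p(1) N])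
    show "real t \<le> p * real N" using t by simp
    obtain f where f: "linear f" "W = {v\<in>V. f v < (0::real)}" using W unfolding F_def by blast
    show "p * real (card ?Q) \<le> real (card {\<sigma>\<in>?Q. hits r (P c) W \<sigma>})" for c
      unfolding p_def by (rule card_hitting_perms_ge[OF r f(1)]) (simp add: f(2))
  qed
  have Qpos: "real (card ?Q) ^ N > 0" by (simp add: card_permutations)
  have "real (card (\<Union>W\<in>F. Bad W)) \<le> (\<Sum>W\<in>F. real (card (Bad W)))"
    using card_UN_le[OF finF, of Bad] by (metis of_nat_le_iff of_nat_sum)
  also have "\<dots> \<le> real (card F) * (real (card ?Q) ^ N * ?\<epsilon>)"
    using card_bad by (intro sum_bounded_above) auto
  also have "\<dots> \<le> real (N * r * r + 1) ^ ((r - 1) * (card B + 1)) * (real (card ?Q) ^ N * ?\<epsilon>)"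
    using cardF by (intro mult_right_mono) auto
  also have "\<dots> < exp ((p * N - t)\<^sup>2 / (4 * (p * N))) * (real (card ?Q) ^ N * ?\<epsilon>)"
    using few Qpos by (intro mult_strict_right_mono) auto
  also have "\<dots> = real (card ?\<Omega>)" by (simp add: exp_minus card_PiE)
  finally have "card (\<Union>W\<in>F. Bad W) < card ?\<Omega>" by simp
  moreover have "finite (\<Union>W\<in>F. Bad W)" using finF finO unfolding Bad_def by auto
  ultimately have "\<not> ?\<Omega> \<subseteq> (\<Union>W\<in>F. Bad W)"
    using card_mono leD by blast
  then obtain g where g: "g \<in> ?\<Omega>" "\<And>W. W \<in> F \<Longrightarrow> g \<notin> Bad W" by blast
  have perm: "g c permutes {..<r}" if "c < N" for c using g(1) that by (auto simp: PiE_def Pi_def)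
  show ?thesis
  proof (rule that[OF colorful_partition_color_part[of N g r, OF perm]])
    fix T assume T: "T \<subseteq> {..<N}" "card T = t"
    define R where "R k = remaining_positions P T (color_part N r g k)" for k
    have R: "P c j \<in> R (g c j)" if "c < N" "c \<notin> T" "j < r" for c j
      using that unfolding R_def remaining_positions_def color_part_def by blast
    have "(\<Inter>k<r. convex hull (R k)) \<noteq> {}"
    proof
      assume disj: "(\<Inter>k<r. convex hull (R k)) = {}"
      have "p * N \<le> 1 * real N" using p by (intro mult_right_mono) auto
      then have "card T < card {..<N}" using T(2) t by simp
      then have "T \<noteq> {..<N}" by auto
      then obtain c0 where c0: "c0 < N" "c0 \<notin> T" using T(1) by blast
      have ne: "\<forall>k<r. R k \<noteq> {}"
      proof (intro allI impI)
        fix k assume "k < r"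
        then have "inv (g c0) k < r"
          using permutes_in_image[OF permutes_inv[OF perm[OF c0(1)]], of k] by simp
        then show "R k \<noteq> {}"
          using R[OF c0] permutes_inverses(1)[OF perm[OF c0(1)]] by (metis empty_iff)
      qed
      have fin: "\<forall>k<r. finite (R k)"
      proof (intro allI impI)
        fix k
        have "R k \<subseteq> (\<lambda>(c, j). P c j) ` ({..<N} \<times> {..<r})"
          unfolding R_def remaining_positions_def color_part_def by auto
        then show "finite (R k)" by (rule finite_subset) auto
      qed
      obtain f where f: "linear f" "\<forall>k<r. \<forall>x\<in>R k. f (?s k x) < (0::real)"
        using sarkaria_separation[OF _ ne fin disj] r by auto
      let ?W = "{v\<in>V. f v < 0}"
      have "?W \<in> F" unfolding F_def using f(1) by blast
      then have "g \<notin> Bad ?W" by (rule g(2))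
      then have big: "card {c. c < N \<and> hits r (P c) ?W (g c)} > t"
        using g(1) unfolding Bad_def by auto
      \<comment> \<open>The lift of every remaining point is negative for \<open>f\<close>, so only removed colors can hit it.\<close>
      have "{c. c < N \<and> hits r (P c) ?W (g c)} \<subseteq> T"
      proof
        fix c assume "c \<in> {c. c < N \<and> hits r (P c) ?W (g c)}"
        then obtain j where c: "c < N" "j < r" "?s (g c j) (P c j) \<notin> ?W"
          unfolding hits_def by auto
        have gr: "g c j < r" using permutes_in_image[OF perm[OF c(1)], of j] c(2) by simp
        have "?s (g c j) (P c j) \<in> V" unfolding V_def using c gr by force
        then have "\<not> f (?s (g c j) (P c j)) < 0" using c(3) by simp
        then have "P c j \<notin> R (g c j)" using f(2) gr by blast
        then show "c \<in> T" using R[of c j] c by blast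
      qed
      then have "card {c. c < N \<and> hits r (P c) ?W (g c)} \<le> card T"
        using T(1) by (intro card_mono finite_subset[OF T(1)]) auto
      then show False using big T(2) by simp
    qed
    then show "(\<Inter>i<r. convex hull (remaining_positions P T (color_part N r g i))) \<noteq> {}"
      unfolding R_def .
  qed
qed

section \<open>The number of colors that suffices\<close>

text \<open>
  Here \<open>x\<close> stands for the excess of \<open>N\<close> over \<open>t / p\<close>, so that \<open>N \<le> 2 t + x\<close>. Since \<open>x\<close> is not bounded above,
  the logarithm is estimated by \<open>8 ln u + z\<close> with \<open>u = 2 + t + d + r\<close> and \<open>z = x / u ^ 5\<close>: the part with
  \<open>ln u\<close> is covered by the lower bound for \<open>x\<close>, and the division by \<open>u ^ 5\<close> makes the part with \<open>z\<close> a small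
  fraction of \<open>x\<^sup>2\<close>.
\<close>
lemma union_bound_numerics:
  fixes t d r x :: real
  assumes t: "t \<ge> 1" and d: "d \<ge> 1" and r: "r \<ge> 2"
    and x: "x \<ge> 512 * (r * sqrt (t * d) + r\<^sup>2 * d) * ln (2 + t + d + r)"
  shows "16 * (2 * t + x) * (r * d) * ln ((2 * t + x) * r\<^sup>2 + 1) < x\<^sup>2"
proof -
  define u where "u = 2 + t + d + r"
  define l where "l = ln u"
  have u: "u \<ge> 6" "t \<le> u" "d \<le> u" "r \<le> u" using t d r unfolding u_def by auto
  have l1: "l \<ge> 1"
  proof -
    have "exp 1 \<le> u" using exp_le u by linarith
    then show ?thesis unfolding l_def using u by (simp add: ln_ge_iff)
  qed
  have td: "t * d > 0" using t d by simp
  have rd: "r * d \<ge> 2" using mult_mono[of 2 r 1 d] r d by simp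
  have x': "x \<ge> 512 * (r * sqrt (t * d)) * l + 512 * (r\<^sup>2 * d) * l"
    using x unfolding u_def[symmetric] l_def[symmetric] by (simp add: algebra_simps)
  have nn1: "512 * (r * sqrt (t * d)) * l \<ge> 0" using r td l1 by simp
  have rrd: "r\<^sup>2 * d \<ge> 2 * (r * d)"
    using mult_right_mono[of 2 r "r * d"] r rd by (simp add: power2_eq_square)
  have x_rd: "x \<ge> 1024 * (r * d) * l"
  proof -
    have "512 * (r\<^sup>2 * d) * l \<ge> 512 * (2 * (r * d)) * l"
      using rrd l1 by (intro mult_right_mono mult_left_mono) auto
    moreover have "512 * (2 * (r * d)) * l = 1024 * (r * d) * l" by simp
    ultimately show ?thesis using x' nn1 by linarith
  qed
  have "1024 * (r * d) * l \<ge> 1024 * 2 * 1" using rd l1 by (intro mult_mono) auto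
  with x_rd have x_big: "x \<ge> 2048" by linarith
  have x_td: "x \<ge> 512 * (r * sqrt (t * d)) * l"
  proof -
    have "512 * (r\<^sup>2 * d) * l \<ge> 0" using d l1 by simp
    then show ?thesis using x' by linarith
  qed
  have sq: "x\<^sup>2 \<ge> 1024 * (t * (r * d)) * l"
  proof -
    have "x\<^sup>2 \<ge> (512 * (r * sqrt (t * d)) * l)\<^sup>2" using x_td nn1 by (rule power_mono)
    also have "(512 * (r * sqrt (t * d)) * l)\<^sup>2 = 262144 * r\<^sup>2 * (t * d) * l\<^sup>2"
      using td by (simp add: power_mult_distrib)
    also have "\<dots> \<ge> 262144 * r * (t * d) * l"
      using r l1 t d by (intro mult_mono) (auto simp: power2_eq_square)
    also have "262144 * r * (t * d) * l \<ge> 1024 * r * (t * d) * l"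
      using r l1 td by (intro mult_right_mono) auto
    finally show ?thesis by (simp add: algebra_simps)
  qed
  define z where "z = x / u ^ 5"
  have z: "z \<ge> 0" unfolding z_def using x_big u by simp
  have "(2 * t + x) * r\<^sup>2 + 1 \<le> u ^ 8 * (1 + z)"
  proof -
    have "r\<^sup>2 \<le> u\<^sup>2" using u r by (intro power_mono) auto
    have "t * r\<^sup>2 \<le> u * u\<^sup>2" using u t \<open>r\<^sup>2 \<le> u\<^sup>2\<close> by (intro mult_mono) auto
    moreover have "2 * (u * u\<^sup>2) + 1 \<le> u ^ 8"
    proof -
      have "u * u\<^sup>2 = u ^ 3" by (simp add: power3_eq_cube power2_eq_square)
      moreover have "(6::real) ^ 5 \<le> u ^ 5" using u by (intro power_mono) auto
      then have "3 * u ^ 3 \<le> u ^ 5 * u ^ 3" using u by (intro mult_right_mono) auto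
      then have "3 * u ^ 3 \<le> u ^ 8" by (simp flip: power_add)
      moreover have "1 \<le> u ^ 3" using u by (intro one_le_power) auto
      ultimately show ?thesis by linarith
    qed
    moreover have "x * r\<^sup>2 \<le> x * u ^ 3"
    proof -
      have "u\<^sup>2 \<le> u ^ 3" using u by (intro power_increasing) auto
      then show ?thesis using \<open>r\<^sup>2 \<le> u\<^sup>2\<close> x_big by (intro mult_left_mono) auto
    qed
    moreover have "u ^ 8 * z = x * u ^ 3"
    proof -
      have "u ^ 8 = u ^ 3 * u ^ 5" by (simp flip: power_add)
      moreover have "u ^ 5 * z = x" unfolding z_def using u by simp
      ultimately show ?thesis by (metis mult.assoc mult.commute)
    qed
    ultimately show ?thesis by (simp add: algebra_simps)
  qed
  moreover have "(2 * t + x) * r\<^sup>2 + 1 > 0" using t x_big by (simp add: add_nonneg_pos)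
  ultimately have "ln ((2 * t + x) * r\<^sup>2 + 1) \<le> ln (u ^ 8 * (1 + z))"
    by (simp add: ln_mono)
  also have "\<dots> = 8 * l + ln (1 + z)"
    using u z unfolding l_def by (simp add: ln_mult ln_realpow)
  also have "\<dots> \<le> 8 * l + z" using z ln_add_one_self_le_self by simp
  finally have ln: "ln ((2 * t + x) * r\<^sup>2 + 1) \<le> 8 * l + z" .
  have rd_u: "r * d \<le> u\<^sup>2" unfolding power2_eq_square using u r d by (intro mult_mono) auto
  have "16 * (2 * t + x) * (r * d) * ln ((2 * t + x) * r\<^sup>2 + 1) \<le> 16 * (2 * t + x) * (r * d) * (8 * l + z)"
    using ln t x_big rd by (intro mult_left_mono) auto
  also have "\<dots> = 256 * (t * (r * d)) * l + 32 * (t * (r * d) * z)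
      + 128 * (r * d) * l * x + 16 * (r * d * z) * x"
    by (simp add: algebra_simps)
  also have "\<dots> < x\<^sup>2"
  proof -
    have a: "256 * (t * (r * d)) * l \<le> x\<^sup>2 / 4" using sq by simp
    have b: "32 * (t * (r * d) * z) \<le> x\<^sup>2 / 8"
    proof -
      have "t * (r * d) \<le> u * u\<^sup>2" using rd_u u t rd by (intro mult_mono) auto
      also have "\<dots> = u ^ 3" by (simp add: power3_eq_cube power2_eq_square)
      also have "\<dots> \<le> u ^ 5" using u by (intro power_increasing) auto
      finally have "t * (r * d) * z \<le> u ^ 5 * z" using z by (intro mult_right_mono)
      also have "\<dots> = x" unfolding z_def using u by simp
      finally have "t * (r * d) * z \<le> x" .
      moreover have "2048 * x \<le> x\<^sup>2"
        unfolding power2_eq_square using x_big by (intro mult_right_mono) auto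
      ultimately show ?thesis using x_big by linarith
    qed
    have c: "128 * (r * d) * l * x \<le> x\<^sup>2 / 4"
    proof -
      have "128 * (r * d) * l \<le> x / 4" using x_rd l1 rd x_big by simp
      then have "128 * (r * d) * l * x \<le> x / 4 * x" using x_big by (intro mult_right_mono) auto
      then show ?thesis by (simp add: power2_eq_square)
    qed
    have e: "16 * (r * d * z) * x \<le> x\<^sup>2 / 8"
    proof -
      have "r * d * z \<le> u\<^sup>2 * z" using rd_u z by (rule mult_right_mono)
      also have "\<dots> = x / u ^ 3"
      proof -
        have "u ^ 5 = u\<^sup>2 * u ^ 3" by (simp flip: power_add)
        then show ?thesis unfolding z_def using u by (simp add: field_simps)
      qed
      also have "\<dots> \<le> x / 6 ^ 3"
        using u x_big by (intro divide_left_mono power_mono mult_pos_pos) auto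
      finally have "16 * (r * d * z) \<le> x / 8" using x_big by simp
      then have "16 * (r * d * z) * x \<le> x / 8 * x" using x_big by (intro mult_right_mono) auto
      then show ?thesis by (simp add: power2_eq_square)
    qed
    have "x\<^sup>2 > 0" using x_big by simp
    then show ?thesis using a b c e by linarith
  qed
  finally show ?thesis .
qed

text \<open>
  Taking logarithms, \<open>(p N - t)\<^sup>2 / (4 p N)\<close> is at least \<open>x\<^sup>2 / (8 N)\<close> for \<open>x = N - t / p\<close>, while the
  exponent \<open>(r - 1) (d + 1)\<close> is at most \<open>2 r d\<close>.
\<close>
lemma patterns_lt_exp:
  fixes t d r N :: nat and p :: real
  assumes t: "t \<ge> 1" and d: "d \<ge> 1" and r: "r \<ge> 2" and p: "1/2 \<le> p" "p \<le> 1"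
    and N: "real N - t / p \<ge> 512 * (r * sqrt (t * d) + (real r)\<^sup>2 * d) * ln (2 + real t + d + r)"
  shows "real (N * r * r + 1) ^ ((r - 1) * (d + 1)) < exp ((p * N - t)\<^sup>2 / (4 * (p * N)))"
proof -
  define x where "x = real N - t / p"
  have "ln (2 + real t + d + r) \<ge> 0" by simp
  then have x0: "x \<ge> 0" using N unfolding x_def
    by (smt (verit) mult_nonneg_nonneg of_nat_0_le_iff real_sqrt_ge_zero zero_le_power2)
  have num: "16 * (2 * t + x) * (r * d) * ln ((2 * t + x) * (real r)\<^sup>2 + 1) < x\<^sup>2"
    using union_bound_numerics[of "real t" "real d" "real r" x] t d r N unfolding x_def by simp
  have Nx: "real N \<le> 2 * t + x"
  proof -
    have "t / p \<le> t / (1/2)" using p by (intro divide_left_mono) auto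
    then show ?thesis unfolding x_def by simp
  qed
  have "t / p > 0" using t p by simp
  then have N0: "real N > 0" using x0 unfolding x_def by linarith
  have M: "real (N * r * r + 1) \<le> (2 * t + x) * (real r)\<^sup>2 + 1"
    using mult_right_mono[OF Nx, of "real r * real r"] by (simp add: power2_eq_square algebra_simps)
  have M1: "real (N * r * r + 1) \<ge> 1" by simp
  let ?L = "ln (real (N * r * r + 1))"
  have L0: "?L \<ge> 0" by simp
  have D: "real ((r - 1) * (d + 1)) \<le> 2 * (r * d)"
  proof -
    have "(r - 1) * (d + 1) \<le> r * (2 * d)" using d by (intro mult_le_mono) auto
    then have "real ((r - 1) * (d + 1)) \<le> real (r * (2 * d))" by (simp only: of_nat_le_iff)
    then show ?thesis by simp
  qed
  have "16 * N * (real r * real d) \<le> 16 * (2 * t + x) * (real r * real d)"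
    using Nx by (intro mult_right_mono) auto
  moreover have "?L \<le> ln ((2 * t + x) * (real r)\<^sup>2 + 1)"
    using M M1 by (intro ln_mono) linarith+
  ultimately have "(16 * N * (r * d)) * ?L \<le> 16 * (2 * t + x) * (r * d) * ln ((2 * t + x) * (real r)\<^sup>2 + 1)"
    using L0 x0 by (intro mult_mono) auto
  then have "(16 * N * (r * d)) * ?L < x\<^sup>2" using num by linarith
  then have "2 * (r * d) * ?L < x\<^sup>2 / (8 * N)" using N0 by (simp add: field_simps)
  moreover have "(p * N - t)\<^sup>2 / (4 * (p * N)) \<ge> x\<^sup>2 / (8 * N)"
  proof -
    have "p * N - t = p * x" unfolding x_def using p by (simp add: field_simps)
    then have "(p * N - t)\<^sup>2 / (4 * (p * N)) = p * (x\<^sup>2 / (4 * N))"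
      using p N0 by (simp add: power_mult_distrib power2_eq_square)
    moreover have "p * (x\<^sup>2 / (4 * N)) \<ge> 1/2 * (x\<^sup>2 / (4 * N))"
      using p by (intro mult_right_mono) auto
    ultimately show ?thesis by simp
  qed
  moreover have "real ((r - 1) * (d + 1)) * ?L \<le> 2 * (r * d) * ?L"
    using D L0 by (rule mult_right_mono)
  ultimately have "real ((r - 1) * (d + 1)) * ?L < (p * N - t)\<^sup>2 / (4 * (p * N))" by linarith
  then have "exp (real ((r - 1) * (d + 1)) * ?L) < exp ((p * N - t)\<^sup>2 / (4 * (p * N)))" by simp
  moreover have "exp (real ((r - 1) * (d + 1)) * ?L) = real (N * r * r + 1) ^ ((r - 1) * (d + 1))"
  proof -
    have "exp ?L = real (N * r * r + 1)" by (rule exp_ln) (use M1 in linarith)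
    then show ?thesis by (simp only: exp_of_nat_mult)
  qed
  ultimately show ?thesis by (simp only:)
qed

lemma real_space_subset_span:
  "real_space d \<subseteq> span ((\<lambda>i. Poly_Mapping.single i 1) ` {..<d})"
proof
  fix x assume "x \<in> real_space d"
  then have keys: "Poly_Mapping.keys x \<subseteq> {..<d}" by (simp add: real_space_def)
  have "x = (\<Sum>i<d. Poly_Mapping.lookup x i *\<^sub>R Poly_Mapping.single i 1)"
  proof (rule poly_mapping_eqI)
    fix j
    have "Poly_Mapping.lookup (\<Sum>i<d. Poly_Mapping.lookup x i *\<^sub>R Poly_Mapping.single i (1::real)) j
        = (\<Sum>i<d. if i = j then Poly_Mapping.lookup x j else 0)"
      unfolding lookup_sum by (rule sum.cong) (auto simp: lookup_scaleR lookup_single when_def)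
    also have "\<dots> = Poly_Mapping.lookup x j"
      using keys by (auto simp: in_keys_iff)
    finally show "Poly_Mapping.lookup x j =
      Poly_Mapping.lookup (\<Sum>i<d. Poly_Mapping.lookup x i *\<^sub>R Poly_Mapping.single i 1) j" by simp
  qed
  also have "\<dots> \<in> span ((\<lambda>i. Poly_Mapping.single i 1) ` {..<d})"
    by (intro span_sum span_scale span_base) auto
  finally show "x \<in> span ((\<lambda>i. Poly_Mapping.single i 1) ` {..<d})" .
qed

text \<open>
  The constant \<open>2048\<close> is four times the \<open>512\<close> of the estimate above: for \<open>r = 2\<close> the term
  \<open>r \<surd>(t d) + r\<^sup>2 d\<close> there is at most four times \<open>\<surd>(t d) + d\<close>.
\<close>
theorem theorem1p5:
  shows "\<exists>K m :: real. K > 0 \<and> m > 0 \<and>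
    (\<forall>t d r N :: nat. \<forall>L :: real. \<forall>P :: nat \<Rightarrow> nat \<Rightarrow> (nat, real) poly_mapping.
       t \<ge> 1 \<longrightarrow> d \<ge> 1 \<longrightarrow> r \<ge> 2 \<longrightarrow>
       L = ln (2 + real t + real d + real r) powr m \<longrightarrow>
       (r \<ge> 3 \<longrightarrow>
          real N \<ge> 1.6 * real t + K * (real r * sqrt (real t * real d) + (real r)\<^sup>2 * real d) * L) \<longrightarrow>
       (r = 2 \<longrightarrow>
          real N \<ge> 2 * real t + K * (sqrt (real t * real d) + real d) * L) \<longrightarrow>
       (\<forall>c<N. \<forall>j<r. P c j \<in> real_space d) \<longrightarrow>
       (\<exists>A :: nat \<Rightarrow> (nat \<times> nat) set.
          colorful_partition N r A \<and>
          (\<forall>T \<subseteq> {..<N}. card T = t \<longrightarrow>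
             (\<Inter>i<r. convex hull (remaining_positions P T (A i))) \<noteq> {})))"
proof (rule exI[of _ "2048::real"], rule exI[of _ "1::real"], intro conjI allI impI)
  fix t d r N :: nat and L :: real and P :: "nat \<Rightarrow> nat \<Rightarrow> (nat, real) poly_mapping"
  assume t: "t \<ge> 1" and d: "d \<ge> 1" and r: "r \<ge> 2"
    and L: "L = ln (2 + real t + real d + real r) powr 1"
    and N3: "r \<ge> 3 \<longrightarrow>
          real N \<ge> 1.6 * real t + 2048 * (real r * sqrt (real t * real d) + (real r)\<^sup>2 * real d) * L"
    and N2: "r = 2 \<longrightarrow> real N \<ge> 2 * real t + 2048 * (sqrt (real t * real d) + real d) * L"
    and P: "\<forall>c<N. \<forall>j<r. P c j \<in> real_space d"
  define p where "p = (if r = 2 then 1/2 else 5/8 :: real)"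
  have "2 + real t + real d + real r > 1" using t by simp
  then have Lln: "L = ln (2 + real t + real d + real r)" and L0: "L > 0" unfolding L by auto
  let ?e = "real r * sqrt (real t * real d) + (real r)\<^sup>2 * real d"
  have e0: "?e > 0" using r d by (intro add_nonneg_pos) auto
  have x: "real N - t / p \<ge> 512 * ?e * L"
  proof (cases "r = 2")
    case True
    have "2048 * (sqrt (real t * real d) + real d) * L = 512 * (4 * sqrt (real t * real d) + 4 * real d) * L"
      by simp
    also have "\<dots> \<ge> 512 * ?e * L"
      using True L0 by (intro mult_right_mono mult_left_mono add_mono) auto
    finally show ?thesis using N2 True unfolding p_def by simp
  next
    case False
    have "2048 * ?e * L \<ge> 512 * ?e * L" using e0 L0 by (intro mult_right_mono) auto
    then show ?thesis using N3 False r unfolding p_def by simp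
  qed
  have p: "1/2 \<le> p" "p \<le> 1" unfolding p_def by auto
  have "512 * ?e * L > 0" using e0 L0 by simp
  then have "t / p < real N" using x by linarith
  then have tN: "real t < p * N" using p by (simp add: field_simps)
  define B where "B = (\<lambda>i. Poly_Mapping.single i (1::real)) ` {..<d}"
  have B: "finite B" "card B \<le> d" unfolding B_def using card_image_le[of "{..<d}"] by auto
  have "real (N * r * r + 1) ^ ((r - 1) * (card B + 1)) \<le> real (N * r * r + 1) ^ ((r - 1) * (d + 1))"
    using B(2) by (intro power_increasing) auto
  also have "\<dots> < exp ((p * N - t)\<^sup>2 / (4 * (p * N)))"
    using patterns_lt_exp[OF t d r p] x unfolding Lln by simp
  finally have few: "real (N * r * r + 1) ^ ((r - 1) * (card B + 1)) < exp ((p * N - t)\<^sup>2 / (4 * (p * N)))" .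
  have PB: "P c j \<in> span B" if "c < N" "j < r" for c j
    using P that real_space_subset_span unfolding B_def by blast
  obtain A where "colorful_partition N r A"
    "\<And>T. T \<subseteq> {..<N} \<Longrightarrow> card T = t \<Longrightarrow> (\<Inter>i<r. convex hull (remaining_positions P T (A i))) \<noteq> {}"
    using tolerant_colorful_tverberg[of r B N P p t, OF r B(1) PB p_def tN few] by blast
  then show "\<exists>A. colorful_partition N r A \<and>
      (\<forall>T\<subseteq>{..<N}. card T = t \<longrightarrow> (\<Inter>i<r. convex hull (remaining_positions P T (A i))) \<noteq> {})"
    by blast
qed simp_all

end
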